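(* Let $F_m$ be the fan graph on $m+1$ vertices. If $m=k^2+c$ for some integer $k>0$ and some integer $c$ with $0\le c\le 2k$, then $$\operatorname{sn}(F_m)=\begin{cases}\lfloor\sqrt{m}\rfloor+1 & \text{if } c\le k+1,\\ \lfloor\sqrt{m}\rfloor+2 & \text{otherwise,}\end{cases}$$ where $\operatorname{sn}$ denotes the scramble number.
   Context: The fan graph $F_m$ is the graph with $m+1$ vertices $v_0,\dots,v_m$, with an edge between $v_0$ and $v_i$ for all $i\ge 1$, and an edge between $v_i$ and $v_j$ whenever $i,j\ge 1$ and $|i-j|=1$. Scramble number. A scramble $\mathcal{S}=\{\mathcal{E}_1,\dots,\mathcal{E}_r\}$ on a graph $G$ is a collection of (nonempty) connected subgraphs of $G$, called eggs. A hitting set for $\mathcal{S}$ is a set of vertices of $G$ having nonempty intersection with each egg; the hitting size $h(\mathcal{S})$ is the minimum size of a hitting set. An egg-cut for $\mathcal{S}$ is a set of edges $C(A,B)=\{e\in E(G) : e=\{a,b\},\ a\in A,\ b\in B\}$, where $V(G)=A\sqcup B$ and at least one egg has all its vertices in $A$ and at least one egg has all its vertices in $B$. The egg-cut size $e(\mathcal{S})$ is the minimum number of edges in an egg-cut, with $e(\mathcal{S})=\infty$ if there is no egg-cut. The order of $\mathcal{S}$ is $\|\mathcal{S}\|=\min\{h(\mathcal{S}),e(\mathcal{S})\}$, and $\operatorname{sn}(G)$ is the maximum of $\|\mathcal{S}\|$ over all scrambles $\mathcal{S}$ on $G$.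
   Formalization: The case m = 1 (k = 1, c = 0) is excluded by assuming m ≥ 2, because F_1 is a single edge with scramble number 1, whereas the stated formula would give 2. *)

theory Defs
  imports Complex_Main "HOL-Library.Extended_Nat"
begin

text \<open>A finite simple graph is a pair of a vertex set and a set of two-element edges.\<close>

type_synonym 'a ugraph = "'a set \<times> 'a set set"

abbreviation verts :: "'a ugraph \<Rightarrow> 'a set" where "verts \<equiv> fst"
abbreviation edges :: "'a ugraph \<Rightarrow> 'a set set" where "edges \<equiv> snd"

definition ugraph :: "'a ugraph \<Rightarrow> bool" where
  "ugraph G \<longleftrightarrow> finite (verts G) \<and> (\<forall>e\<in>edges G. e \<subseteq> verts G \<and> card e = 2)"

definition subgraph :: "'a ugraph \<Rightarrow> 'a ugraph \<Rightarrow> bool" where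
  "subgraph H G \<longleftrightarrow> ugraph H \<and> verts H \<subseteq> verts G \<and> edges H \<subseteq> edges G"

definition connected_graph :: "'a ugraph \<Rightarrow> bool" where
  "connected_graph G \<longleftrightarrow> verts G \<noteq> {} \<and>
     (\<forall>u\<in>verts G. \<forall>v\<in>verts G. (u, v) \<in> {(x, y). {x, y} \<in> edges G}\<^sup>*)"

text \<open>The empty scramble is admitted; it has hitting size, hence order, 0, so it does not
  affect the scramble number of a graph with at least one vertex.\<close>

definition scramble :: "'a ugraph \<Rightarrow> 'a ugraph set \<Rightarrow> bool" where
  "scramble G S \<longleftrightarrow> (\<forall>H\<in>S. subgraph H G \<and> connected_graph H)"

definition hitting_set :: "'a ugraph \<Rightarrow> 'a ugraph set \<Rightarrow> 'a set \<Rightarrow> bool" where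
  "hitting_set G S T \<longleftrightarrow> T \<subseteq> verts G \<and> (\<forall>H\<in>S. T \<inter> verts H \<noteq> {})"

definition hitting_size :: "'a ugraph \<Rightarrow> 'a ugraph set \<Rightarrow> nat" where
  "hitting_size G S = Min {card T | T. hitting_set G S T}"

definition cut :: "'a ugraph \<Rightarrow> 'a set \<Rightarrow> 'a set \<Rightarrow> 'a set set" where
  "cut G A B = {e \<in> edges G. \<exists>a\<in>A. \<exists>b\<in>B. e = {a, b}}"

definition egg_cuts :: "'a ugraph \<Rightarrow> 'a ugraph set \<Rightarrow> 'a set set set" where
  "egg_cuts G S = {cut G A B | A B. A \<union> B = verts G \<and> A \<inter> B = {} \<and>
     (\<exists>H\<in>S. verts H \<subseteq> A) \<and> (\<exists>H\<in>S. verts H \<subseteq> B)}"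

text \<open>In \<^typ>\<open>enat\<close> the infimum over the empty set is \<open>\<infinity>\<close>, as wanted when there is no egg-cut.\<close>

definition egg_cut_size :: "'a ugraph \<Rightarrow> 'a ugraph set \<Rightarrow> enat" where
  "egg_cut_size G S = (INF C\<in>egg_cuts G S. enat (card C))"

definition scramble_order :: "'a ugraph \<Rightarrow> 'a ugraph set \<Rightarrow> enat" where
  "scramble_order G S = min (enat (hitting_size G S)) (egg_cut_size G S)"

definition scramble_number :: "'a ugraph \<Rightarrow> enat" where
  "scramble_number G = Max {scramble_order G S | S. scramble G S}"

definition fan_graph :: "nat \<Rightarrow> nat ugraph" where
  "fan_graph m = ({0..m},
     {{0, i} | i. 1 \<le> i \<and> i \<le> m} \<union>
     {{i, j} | i j. 1 \<le> i \<and> i \<le> m \<and> 1 \<le> j \<and> j \<le> m \<and> \<bar>int i - int j\<bar> = 1})"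

end

theory Submission
  imports Defs
begin

text \<open>
  View the fan as the Hamiltonian cycle \<open>0, 1, \<dots>, m, 0\<close> together with the chords from the hub \<open>0\<close>
  to the inner path vertices \<open>2, \<dots>, m - 1\<close>. If \<open>B\<close> is a nonempty set of path vertices, then the
  edges leaving \<open>B\<close> include the chords at the vertices of \<open>B - {1, m}\<close> and the two cycle edges
  leaving \<open>B\<close> below its minimum and above its maximum; when \<open>B\<close> is an interval there are no others.
  So the cut has at least \<open>card (B - {1, m}) + 2\<close> edges, with equality for intervals
  (\<open>card_fan_cut_ge\<close>, \<open>card_fan_cut_interval_le\<close>).

  Upper bound (\<open>fan_scramble_order_upper\<close>): let a scramble have order at least \<open>s + 2\<close> with
  \<open>s \<ge> 1\<close>. Eggs that avoid the hub are intervals of the path, and for intervals a greedy choice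
  gives as many pairwise disjoint members as there are points in some hitting set
  (\<open>interval_hitting_packing\<close>). Adding the hub to these points hits every egg, so there are at least
  \<open>s + 1\<close> disjoint interval eggs. Any one of them is separated from any other by its own boundary,
  hence has at least \<open>s\<close> vertices in \<open>{2..m - 1}\<close>, and \<open>m - 2 \<ge> s * (s + 1)\<close> follows.

  Lower bound (\<open>fan_scramble_order_lower\<close>): take the hub as an egg together with all path segments
  of length \<open>k\<close>. Using the segments in \<open>{1..m}\<close> always gives order at least \<open>k + 1\<close>. Using only
  those in \<open>{2..m - 1}\<close> raises every egg-cut to \<open>k + 2\<close> edges, and \<open>k + 1\<close> disjoint segments fit
  there exactly when \<open>m \<ge> k * (k + 1) + 2\<close>, the threshold of the upper bound.
\<close>

section \<open>Scramble orders on a finite graph\<close>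

lemma finite_hitting_cards:
  assumes "finite (verts G)"
  shows "finite {card T | T. hitting_set G S T}"
proof -
  have "{card T | T. hitting_set G S T} \<subseteq> card ` Pow (verts G)"
    by (auto simp: hitting_set_def)
  then show ?thesis
    using assms finite_subset by blast
qed

lemma hitting_size_le:
  assumes "finite (verts G)" "hitting_set G S T"
  shows "hitting_size G S \<le> card T"
  unfolding hitting_size_def using assms by (intro Min_le finite_hitting_cards) auto

lemma hitting_set_verts:
  assumes "scramble G S"
  shows "hitting_set G S (verts G)"
  using assms unfolding hitting_set_def scramble_def subgraph_def connected_graph_def by blast

lemma le_hitting_size:
  assumes "finite (verts G)" "scramble G S"
    and "\<And>T. hitting_set G S T \<Longrightarrow> n \<le> card T"
  shows "n \<le> hitting_size G S"
  unfolding hitting_size_def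
proof (rule Min.boundedI)
  show "{card T | T. hitting_set G S T} \<noteq> {}"
    using hitting_set_verts[OF assms(2)] by blast
qed (use assms finite_hitting_cards[OF assms(1)] in auto)

lemma le_scramble_order_iff:
  "enat n \<le> scramble_order G S \<longleftrightarrow>
     n \<le> hitting_size G S \<and> (\<forall>C\<in>egg_cuts G S. n \<le> card C)"
  by (simp add: scramble_order_def egg_cut_size_def le_INF_iff)

lemma scramble_number_eqI:
  assumes fin: "finite (verts G)" and S: "scramble G S" "enat n \<le> scramble_order G S"
    and upper: "\<And>S'. scramble G S' \<Longrightarrow> \<not> enat (Suc n) \<le> scramble_order G S'"
  shows "scramble_number G = enat n"
  unfolding scramble_number_def
proof (rule Max_eqI)
  have le: "scramble_order G S' \<le> enat n" if "scramble G S'" for S'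
    using upper[OF that] by (metis Suc_ile_eq not_le)
  then show "\<And>y. y \<in> {scramble_order G S |S. scramble G S} \<Longrightarrow> y \<le> enat n"
    by blast
  then show "finite {scramble_order G S |S. scramble G S}"
    by (rule finite_enat_bounded)
  have "scramble_order G S = enat n"
    using le S by (simp add: antisym)
  then show "enat n \<in> {scramble_order G S |S. scramble G S}"
    using S(1) by (metis (mono_tags, lifting) mem_Collect_eq)
qed

lemma cut_commute: "cut G A B = cut G B A"
  unfolding cut_def by (auto simp: insert_commute)

section \<open>Edges and cuts of the fan\<close>

lemma verts_fan [simp]: "verts (fan_graph m) = {0..m}"
  by (simp add: fan_graph_def)

lemma fan_edge_iff:
  assumes "y \<noteq> 0"
  shows "{x, y} \<in> edges (fan_graph m) \<longleftrightarrow>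
    x \<le> m \<and> y \<le> m \<and> (x = 0 \<or> x = Suc y \<or> y = Suc x)"
proof
  assume "{x, y} \<in> edges (fan_graph m)"
  then show "x \<le> m \<and> y \<le> m \<and> (x = 0 \<or> x = Suc y \<or> y = Suc x)"
    using assms by (auto simp: fan_graph_def doubleton_eq_iff)
next
  assume *: "x \<le> m \<and> y \<le> m \<and> (x = 0 \<or> x = Suc y \<or> y = Suc x)"
  show "{x, y} \<in> edges (fan_graph m)"
  proof (cases "x = 0")
    case True
    with * assms show ?thesis by (auto simp: fan_graph_def Suc_le_eq)
  next
    case False
    with * assms have "1 \<le> x \<and> x \<le> m \<and> 1 \<le> y \<and> y \<le> m \<and> \<bar>int x - int y\<bar> = 1"
      by auto
    then show ?thesis unfolding fan_graph_def snd_conv by blast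
  qed
qed

lemma finite_fan_edges: "finite (edges (fan_graph m))"
proof -
  have "edges (fan_graph m) \<subseteq> Pow {0..m}"
    by (auto simp: fan_graph_def)
  then show ?thesis
    by (rule finite_subset) simp
qed

text \<open>The chords at \<open>B\<close> and the two cycle edges that leave the span \<open>{a..b}\<close> of \<open>B\<close>. For \<open>a = 1\<close> the
  lower cycle edge \<open>{a - 1, a}\<close> is the spoke at \<open>1\<close>; for \<open>b = m\<close> the upper one is the spoke at \<open>m\<close>.\<close>

definition fan_boundary :: "nat \<Rightarrow> nat set \<Rightarrow> nat \<Rightarrow> nat \<Rightarrow> nat set set" where
  "fan_boundary m B a b = (\<lambda>i. {0, i}) ` (B - {1, m}) \<union>
     {{a - 1, a}, {b, if b = m then 0 else Suc b}}"

lemma card_fan_boundary_le: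
  assumes "finite B"
  shows "card (fan_boundary m B a b) \<le> card (B - {1, m}) + 2"
proof -
  have "card (fan_boundary m B a b) \<le> card ((\<lambda>i. {0, i}) ` (B - {1, m}))
      + card {{a - 1, a}, {b, if b = m then 0 else Suc b}}"
    unfolding fan_boundary_def by (rule card_Un_le)
  also have "\<dots> \<le> card (B - {1, m}) + 2"
    using assms by (intro add_mono card_image_le) (auto simp: card_insert_if)
  finally show ?thesis .
qed

text \<open>The two cycle edges are different because the cycle has at least three vertices.\<close>

lemma card_fan_boundary:
  assumes "2 \<le> m" "1 \<le> a" "a \<le> b" "b \<le> m" "finite B" "0 \<notin> B"
  shows "card (fan_boundary m B a b) = card (B - {1, m}) + 2"
proof -
  have "card ((\<lambda>i. {0, i}) ` (B - {1, m})) = card (B - {1, m})"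
    by (rule card_image) (auto simp: inj_on_def doubleton_eq_iff)
  moreover have "{a - 1, a} \<noteq> {b, if b = m then 0 else Suc b}"
    using assms by (auto simp: doubleton_eq_iff)
  then have "card {{a - 1, a}, {b, if b = m then 0 else Suc b}} = 2"
    by (subst card_2_iff) blast
  moreover have "(\<lambda>i. {0, i}) ` (B - {1, m}) \<inter> {{a - 1, a}, {b, if b = m then 0 else Suc b}} = {}"
    using assms by (auto simp: doubleton_eq_iff)
  ultimately show ?thesis
    unfolding fan_boundary_def using assms by (subst card_Un_disjoint) auto
qed

lemma card_fan_cut_ge:
  assumes "2 \<le> m" "A \<union> B = {0..m}" "A \<inter> B = {}" "0 \<in> A" "B \<noteq> {}"
  shows "card (B - {1, m}) + 2 \<le> card (cut (fan_graph m) A B)"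
proof -
  have fin: "finite B"
    using assms(2) by (metis finite_Un finite_atLeastAtMost)
  have "0 \<notin> B" using assms by auto
  define a b where "a = Min B" and "b = Max B"
  have a: "a \<in> B" and b: "b \<in> B" and ab: "\<And>x. x \<in> B \<Longrightarrow> a \<le> x \<and> x \<le> b"
    using fin assms(5) by (auto simp: a_def b_def)
  have range: "1 \<le> a" "a \<le> b" "b \<le> m"
    using a b ab assms \<open>0 \<notin> B\<close> by (auto simp: Suc_le_eq intro: gr0I)
  have cutI: "{x, y} \<in> cut (fan_graph m) A B" if "x \<in> A" "y \<in> B" "x = 0 \<or> x = Suc y \<or> y = Suc x" for x y
  proof -
    have "y \<noteq> 0" using that(2) \<open>0 \<notin> B\<close> by metis
    moreover have "x \<le> m" "y \<le> m" using that(1,2) assms(2) by auto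
    ultimately have "{x, y} \<in> edges (fan_graph m)" using that fan_edge_iff by blast
    then show ?thesis using that unfolding cut_def by blast
  qed
  have "a - 1 \<in> A"
    using ab[of "a - 1"] range assms(2) by fastforce
  then have "{a - 1, a} \<in> cut (fan_graph m) A B"
    using cutI[of "a - 1" a] a range by auto
  moreover have "{b, if b = m then 0 else Suc b} \<in> cut (fan_graph m) A B"
  proof (cases "b = m")
    case False
    then have "Suc b \<in> A"
      using ab[of "Suc b"] range assms(2) by fastforce
    then show ?thesis
      using cutI[of "Suc b" b] b False by (simp add: insert_commute)
  qed (use cutI[of 0 b] b assms in \<open>simp add: insert_commute\<close>)
  moreover have "(\<lambda>i. {0, i}) ` (B - {1, m}) \<subseteq> cut (fan_graph m) A B"
    using cutI[of 0] assms by auto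
  ultimately have "fan_boundary m B a b \<subseteq> cut (fan_graph m) A B"
    unfolding fan_boundary_def by blast
  moreover have "finite (cut (fan_graph m) A B)"
    using finite_fan_edges by (rule rev_finite_subset) (auto simp: cut_def)
  ultimately show ?thesis
    using card_mono card_fan_boundary[OF assms(1) range fin \<open>0 \<notin> B\<close>] by metis
qed

lemma card_fan_cut_interval_le:
  assumes "1 \<le> a" "b \<le> m"
  shows "card (cut (fan_graph m) ({0..m} - {a..b}) {a..b}) \<le> card ({a..b} - {1, m}) + 2"
proof -
  have "cut (fan_graph m) ({0..m} - {a..b}) {a..b} \<subseteq> fan_boundary m {a..b} a b"
  proof
    fix e assume "e \<in> cut (fan_graph m) ({0..m} - {a..b}) {a..b}"
    then obtain x y where e: "e = {x, y}" "{x, y} \<in> edges (fan_graph m)"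
      and xy: "x \<le> m" "x \<notin> {a..b}" "a \<le> y" "y \<le> b"
      by (auto simp: cut_def)
    have "y \<noteq> 0" using xy assms by auto
    then have "x = 0 \<or> x = Suc y \<or> y = Suc x"
      using e fan_edge_iff by auto
    then consider "x = 0" "y \<in> {a..b} - {1, m}" | "x = a - 1" "y = a" | "x = 0" "y = m" "b = m"
      | "x = Suc b" "y = b" "b \<noteq> m"
      using xy assms by fastforce
    then show "e \<in> fan_boundary m {a..b} a b"
      by cases (auto simp: e fan_boundary_def)
  qed
  moreover have "finite (fan_boundary m {a..b} a b)"
    by (simp add: fan_boundary_def)
  ultimately show ?thesis
    using card_mono card_fan_boundary_le[of "{a..b}" m a b] by (meson finite_atLeastAtMost le_trans)
qed

section \<open>Upper bound by packing disjoint eggs\<close>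

text \<open>The induction is the greedy sweep from the left: the smallest right end point \<open>b\<close> hits every
  interval starting at or before \<open>b\<close>, and all others are disjoint from the interval ending at \<open>b\<close>.\<close>

lemma interval_hitting_packing:
  fixes F :: "'a::linorder set set"
  assumes "finite F" "\<And>I. I \<in> F \<Longrightarrow> \<exists>a b. a \<le> b \<and> I = {a..b}"
  shows "\<exists>T D. T \<subseteq> \<Union>F \<and> finite T \<and> (\<forall>I\<in>F. T \<inter> I \<noteq> {}) \<and>
           D \<subseteq> F \<and> pairwise disjnt D \<and> card D = card T"
  using assms
proof (induction F rule: finite_psubset_induct)
  case (psubset F)
  show ?case
  proof (cases "F = {}")
    case True
    then show ?thesis
      by (intro exI[of _ "{}"]) auto
  next
    case False
    define b where "b = Min {b. \<exists>a. a \<le> b \<and> {a..b} \<in> F}"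
    have "{b. \<exists>a. a \<le> b \<and> {a..b} \<in> F} \<subseteq> (\<lambda>I. GREATEST x. x \<in> I) ` F"
    proof
      fix d assume "d \<in> {b. \<exists>a. a \<le> b \<and> {a..b} \<in> F}"
      then obtain c where c: "c \<le> d" "{c..d} \<in> F" by blast
      then have "(GREATEST x. x \<in> {c..d}) = d"
        by (intro Greatest_equality) auto
      then show "d \<in> (\<lambda>I. GREATEST x. x \<in> I) ` F"
        using c(2) by (rule image_eqI[OF sym])
    qed
    then have fin: "finite {b. \<exists>a. a \<le> b \<and> {a..b} \<in> F}"
      using \<open>finite F\<close> finite_surj by blast
    have ne: "{b. \<exists>a. a \<le> b \<and> {a..b} \<in> F} \<noteq> {}"
      using False psubset.prems by force
    obtain a where a: "a \<le> b" "{a..b} \<in> F"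
      using Min_in[OF fin ne] by (auto simp: b_def)
    have b_le: "b \<le> d" if "c \<le> d" "{c..d} \<in> F" for c d
      unfolding b_def using fin that by (intro Min_le) auto
    define F' where "F' = {I \<in> F. b \<notin> I}"
    have "{a..b} \<notin> F'" using a by (auto simp: F'_def)
    with a(2) have "F' \<subset> F" unfolding F'_def by blast
    moreover have "\<exists>a b. a \<le> b \<and> I = {a..b}" if "I \<in> F'" for I
      using psubset.prems that by (simp add: F'_def)
    ultimately have "\<exists>T D. T \<subseteq> \<Union>F' \<and> finite T \<and> (\<forall>I\<in>F'. T \<inter> I \<noteq> {}) \<and>
        D \<subseteq> F' \<and> pairwise disjnt D \<and> card D = card T"
      by (rule psubset.IH)
    then obtain T D
      where T: "T \<subseteq> \<Union>F'" "finite T" "\<forall>I\<in>F'. T \<inter> I \<noteq> {}"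
        and D: "D \<subseteq> F'" "pairwise disjnt D" "card D = card T"
      by (elim exE conjE)
    have "finite D"
      by (rule finite_subset[OF _ \<open>finite F\<close>]) (use D(1) in \<open>auto simp: F'_def\<close>)
    have disj: "disjnt {a..b} I" if "I \<in> F'" for I
    proof -
      have "I \<in> F" using that by (simp add: F'_def)
      then obtain c d where cd: "c \<le> d" "I = {c..d}"
        using psubset.prems by blast
      then have "b \<le> d" "b \<notin> {c..d}" using that b_le by (auto simp: F'_def)
      then show ?thesis using cd by (auto simp: disjnt_def)
    qed
    have "b \<notin> T" using T(1) by (auto simp: F'_def)
    moreover have "{a..b} \<notin> D" using D(1) \<open>{a..b} \<notin> F'\<close> by blast
    ultimately have "card (insert {a..b} D) = card (insert b T)"
      using D(3) T(2) \<open>finite D\<close> by simp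
    moreover have "pairwise disjnt (insert {a..b} D)"
      using D disj by (auto simp: pairwise_insert disjnt_sym)
    moreover have "insert {a..b} D \<subseteq> F"
      using D(1) a by (auto simp: F'_def)
    moreover have "\<forall>I\<in>F. insert b T \<inter> I \<noteq> {}"
      using T(3) by (auto simp: F'_def)
    moreover have "insert b T \<subseteq> \<Union>F"
    proof -
      have "b \<in> {a..b}" using a(1) by simp
      then show ?thesis using T(1) a(2) unfolding F'_def by blast
    qed
    ultimately show ?thesis
      using T(2) by (meson finite_insert)
  qed
qed

lemma fan_egg_interval:
  assumes H: "subgraph H (fan_graph m)" "connected_graph H" and "0 \<notin> verts H"
  shows "\<exists>a b. 1 \<le> a \<and> a \<le> b \<and> b \<le> m \<and> verts H = {a..b}"
proof -
  have V: "verts H \<subseteq> {0..m}" "verts H \<noteq> {}"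
    using H by (auto simp: subgraph_def connected_graph_def)
  then have fin: "finite (verts H)" using finite_subset by blast
  define a b where "a = Min (verts H)" and "b = Max (verts H)"
  have a: "a \<in> verts H" and b: "b \<in> verts H"
    and ab: "\<And>x. x \<in> verts H \<Longrightarrow> a \<le> x \<and> x \<le> b"
    using fin V by (auto simp: a_def b_def)
  have "x \<in> verts H" if x: "a \<le> x" "x \<le> b" for x
  proof (rule ccontr)
    assume "x \<notin> verts H"
    \<comment> \<open>An edge that avoids the hub cannot jump over the missing vertex \<open>x\<close>.\<close>
    have step: "v < x" if "u < x" "{u, v} \<in> edges H" for u v
    proof -
      have "{u, v} \<in> edges (fan_graph m)" "u \<in> verts H" "v \<in> verts H"
        using that H by (auto simp: subgraph_def ugraph_def)
      moreover from this have "u \<noteq> 0" "v \<noteq> 0" "v \<noteq> x"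
        using assms(3) \<open>x \<notin> verts H\<close> by metis+
      ultimately show ?thesis using fan_edge_iff that(1) by fastforce
    qed
    have "(a, b) \<in> {(x, y). {x, y} \<in> edges H}\<^sup>*"
      using H(2) a b by (simp add: connected_graph_def)
    then have "b < x"
    proof (induction rule: rtrancl_induct)
      case base
      then show ?case using a x \<open>x \<notin> verts H\<close> by (metis le_neq_implies_less)
    qed (use step in auto)
    with x show False by simp
  qed
  then have "{a..b} \<subseteq> verts H" by (meson atLeastAtMost_iff subsetI)
  moreover have "verts H \<subseteq> {a..b}" using ab by (meson atLeastAtMost_iff subsetI)
  ultimately have "verts H = {a..b}" by (rule equalityI[rotated])
  moreover have "a \<noteq> 0"
    using a assms(3) by metis
  moreover have "a \<le> b" "b \<le> m"
    using a b ab[OF a] V(1) by auto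
  ultimately show ?thesis
    by (intro exI[of _ a] exI[of _ b]) simp
qed

lemma fan_scramble_order_upper:
  assumes "2 \<le> m" "1 \<le> s" and S: "scramble (fan_graph m) S"
    and order: "enat (s + 2) \<le> scramble_order (fan_graph m) S"
  shows "s * (s + 1) + 2 \<le> m"
proof -
  let ?G = "fan_graph m"
  define F where "F = verts ` {H \<in> S. 0 \<notin> verts H}"
  have F: "\<exists>a b. 1 \<le> a \<and> a \<le> b \<and> b \<le> m \<and> I = {a..b}" if "I \<in> F" for I
    using that S fan_egg_interval by (auto simp: F_def scramble_def)
  have "F \<subseteq> Pow {0..m}"
    using F by force
  then have "finite F"
    by (rule finite_subset) simp
  moreover have "\<exists>a b. a \<le> b \<and> I = {a..b}" if "I \<in> F" for I
    using F[OF that] by blast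
  ultimately obtain T D where T: "T \<subseteq> \<Union>F" "finite T" "\<forall>I\<in>F. T \<inter> I \<noteq> {}"
    and D: "D \<subseteq> F" "pairwise disjnt D" "card D = card T"
    using interval_hitting_packing[of F] by metis
  have "hitting_set ?G S (insert 0 T)"
  proof -
    have "insert 0 T \<subseteq> verts ?G"
      using T(1) \<open>F \<subseteq> Pow {0..m}\<close> by fastforce
    moreover have "insert 0 T \<inter> verts H \<noteq> {}" if "H \<in> S" for H
    proof (cases "0 \<in> verts H")
      case False
      then have "verts H \<in> F" using that by (simp add: F_def)
      then show ?thesis using T(3) by blast
    qed auto
    ultimately show ?thesis by (simp add: hitting_set_def)
  qed
  then have "s + 2 \<le> card (insert 0 T)"
    using order hitting_size_le[of ?G S] by (fastforce simp: le_scramble_order_iff)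
  then have card_D: "s + 1 \<le> card D"
    using D(3) T(2) by (simp add: card_insert_if split: if_splits)
  have "finite D"
    using \<open>finite F\<close> D(1) finite_subset by blast
  have large: "s \<le> card (I - {1, m})" if "I \<in> D" for I
  proof -
    have "I \<in> F" using that D by blast
    then obtain a b where I: "1 \<le> a" "a \<le> b" "b \<le> m" "I = {a..b}"
      using F by blast
    \<comment> \<open>Here \<open>s \<ge> 1\<close> enters: the cut around \<open>I\<close> is an egg-cut because another egg lies outside \<open>I\<close>.\<close>
    have "\<exists>J\<in>D. J \<noteq> I"
    proof (rule ccontr)
      assume "\<not> (\<exists>J\<in>D. J \<noteq> I)"
      then have "D \<subseteq> {I}" by blast
      then have "card D \<le> 1" using card_mono[of "{I}" D] by simp
      with card_D assms(2) show False by simp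
    qed
    then obtain J where J: "J \<in> D" "J \<noteq> I" by blast
    then have "J \<inter> I = {}"
      using D(2) that by (auto simp: pairwise_def disjnt_def)
    moreover have "J \<in> F" using J D by blast
    ultimately have "J \<subseteq> {0..m} - I"
      using \<open>F \<subseteq> Pow {0..m}\<close> by blast
    moreover have "({0..m} - I) \<union> I = verts ?G" "({0..m} - I) \<inter> I = {}"
      using \<open>I \<in> F\<close> \<open>F \<subseteq> Pow {0..m}\<close> by auto
    moreover have "\<exists>H\<in>S. verts H = I" "\<exists>H\<in>S. verts H = J"
      using \<open>I \<in> F\<close> \<open>J \<in> F\<close> by (auto simp: F_def)
    ultimately have "cut ?G ({0..m} - I) I \<in> egg_cuts ?G S"
      unfolding egg_cuts_def by blast
    then have "s + 2 \<le> card (cut ?G ({0..m} - I) I)"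
      using order by (auto simp: le_scramble_order_iff)
    also have "\<dots> \<le> card (I - {1, m}) + 2"
      using card_fan_cut_interval_le I by simp
    finally show ?thesis by simp
  qed
  have "s * (s + 1) \<le> s * card D"
    using card_D by (intro mult_left_mono) auto
  also have "\<dots> = (\<Sum>I\<in>D. s)"
    by simp
  also have "\<dots> \<le> (\<Sum>I\<in>D. card (I - {1, m}))"
    by (rule sum_mono) (rule large)
  also have "\<dots> = card (\<Union>I\<in>D. I - {1, m})"
  proof (rule card_UN_disjoint[symmetric])
    show "\<forall>I\<in>D. finite (I - {1, m})"
      using D(1) F by fastforce
    show "\<forall>I\<in>D. \<forall>J\<in>D. I \<noteq> J \<longrightarrow> (I - {1, m}) \<inter> (J - {1, m}) = {}"
      using D(2) by (fastforce simp: pairwise_def disjnt_def)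
  qed (rule \<open>finite D\<close>)
  also have "\<dots> \<le> card {2..m - 1}"
  proof (rule card_mono)
    show "(\<Union>I\<in>D. I - {1, m}) \<subseteq> {2..m - 1}"
    proof
      fix x assume "x \<in> (\<Union>I\<in>D. I - {1, m})"
      then obtain I where "I \<in> F" "x \<in> I" "x \<noteq> 1" "x \<noteq> m"
        using D(1) by blast
      with F[of I] show "x \<in> {2..m - 1}" by auto
    qed
  qed simp
  finally show ?thesis using assms(1) by simp
qed

section \<open>Scrambles attaining the bound\<close>

definition path_segment :: "nat \<Rightarrow> nat \<Rightarrow> nat ugraph" where
  "path_segment a l = ({a..<a + l}, {{i, Suc i} | i. a \<le> i \<and> Suc i < a + l})"

lemma verts_path_segment [simp]: "verts (path_segment a l) = {a..<a + l}"
  by (simp add: path_segment_def)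

lemma connected_path_segment:
  assumes "0 < l"
  shows "connected_graph (path_segment a l)"
proof -
  let ?R = "{(x, y). {x, y} \<in> edges (path_segment a l)}"
  have sym: "sym (?R\<^sup>*)"
    by (rule sym_rtrancl) (auto simp: sym_def insert_commute)
  have left: "(a, a + d) \<in> ?R\<^sup>*" if "d < l" for d
    using that
  proof (induction d)
    case (Suc d)
    then have "(a + d, a + Suc d) \<in> ?R"
      by (auto simp: path_segment_def)
    with Suc show ?case
      by (meson Suc_lessD rtrancl.rtrancl_into_rtrancl)
  qed simp
  have "(u, v) \<in> ?R\<^sup>*" if "u \<in> {a..<a + l}" "v \<in> {a..<a + l}" for u v
  proof -
    have "(a, u) \<in> ?R\<^sup>*" "(a, v) \<in> ?R\<^sup>*"
      using left[of "u - a"] left[of "v - a"] that by auto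
    then show ?thesis
      using sym by (meson rtrancl_trans symD)
  qed
  then show ?thesis
    using assms by (simp add: connected_graph_def)
qed

lemma path_segment_subgraph:
  assumes "1 \<le> a" "a + l \<le> Suc m"
  shows "subgraph (path_segment a l) (fan_graph m)"
proof -
  have "{i, Suc i} \<in> edges (fan_graph m)" if "a \<le> i" "Suc i < a + l" for i
    using that assms by (subst fan_edge_iff) auto
  then show ?thesis
    using assms by (auto simp: subgraph_def ugraph_def path_segment_def)
qed

definition segment_scramble :: "nat \<Rightarrow> nat \<Rightarrow> nat \<Rightarrow> nat ugraph set" where
  "segment_scramble p q l = insert ({0}, {}) {path_segment a l | a. p \<le> a \<and> a + l \<le> Suc q}"

lemma scramble_segment_scramble:
  assumes "1 \<le> p" "q \<le> m" "0 < l"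
  shows "scramble (fan_graph m) (segment_scramble p q l)"
proof -
  have "subgraph ({0}, {}) (fan_graph m)" "connected_graph ({0::nat}, {})"
    by (auto simp: subgraph_def ugraph_def connected_graph_def)
  then show ?thesis
    using assms connected_path_segment path_segment_subgraph
    by (auto simp: scramble_def segment_scramble_def)
qed

text \<open>The hitting size is witnessed by the hub and the \<open>n\<close> consecutive blocks of length \<open>l\<close> that
  start at \<open>p\<close>; the block that contains \<open>t\<close> has number \<open>(t - p) div l\<close>.\<close>

lemma fan_scramble_order_lower:
  assumes "2 \<le> m" "1 \<le> p" "q \<le> m" "0 < l" "p + n * l \<le> Suc q"
    and inner: "\<And>a. p \<le> a \<Longrightarrow> a + l \<le> Suc q \<Longrightarrow> N \<le> card ({a..<a + l} - {1, m}) + 2"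
    and "N \<le> n + 1"
  shows "enat N \<le> scramble_order (fan_graph m) (segment_scramble p q l)"
proof -
  let ?G = "fan_graph m" and ?S = "segment_scramble p q l"
  have "N \<le> card T" if T: "hitting_set ?G ?S T" for T
  proof -
    have "T \<subseteq> {0..m}" using T by (simp add: hitting_set_def)
    then have fin: "finite T" by (rule finite_subset) simp
    have "0 \<in> T" using T by (auto simp: hitting_set_def segment_scramble_def)
    have "i \<in> (\<lambda>t. (t - p) div l) ` (T - {0})" if "i < n" for i
    proof -
      have "Suc i * l \<le> n * l"
        using that by (intro mult_right_mono) auto
      then have "path_segment (p + i * l) l \<in> ?S"
        using assms(5) by (auto simp: segment_scramble_def)
      then have "T \<inter> {p + i * l..<p + i * l + l} \<noteq> {}"
        using T by (metis hitting_set_def verts_path_segment)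
      then obtain t where t: "t \<in> T" "p + i * l \<le> t" "t < p + i * l + l"
        by auto
      then have "(t - p) div l = i"
        by (intro div_nat_eqI) (auto simp: algebra_simps)
      then show ?thesis
        using t assms(2) by auto
    qed
    then have "{..<n} \<subseteq> (\<lambda>t. (t - p) div l) ` (T - {0})" by blast
    then have "n \<le> card (T - {0})"
      using fin surj_card_le[of "T - {0}" "{..<n}"] by simp
    then show ?thesis
      using \<open>0 \<in> T\<close> fin assms(7) card_Suc_Diff1[of T 0] by simp
  qed
  then have "N \<le> hitting_size ?G ?S"
    using scramble_segment_scramble assms by (intro le_hitting_size) auto
  moreover have "N \<le> card C" if egg_cut: "C \<in> egg_cuts ?G ?S" for C
  proof -
    have side: "N \<le> card (cut ?G A B)"
      if AB: "A \<union> B = {0..m}" "A \<inter> B = {}" and H: "H \<in> ?S" "verts H \<subseteq> B" and "0 \<in> A" for A B H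
    proof -
      have "H \<noteq> ({0}, {})" using AB(2) H(2) \<open>0 \<in> A\<close> by auto
      then obtain a where a: "p \<le> a" "a + l \<le> Suc q" "{a..<a + l} \<subseteq> B"
        using H unfolding segment_scramble_def by auto
      have "finite B"
        using AB by (metis finite_Un finite_atLeastAtMost)
      then have "card ({a..<a + l} - {1, m}) \<le> card (B - {1, m})"
        using a by (intro card_mono) auto
      moreover have "B \<noteq> {}"
        using a assms(4) by auto
      ultimately show ?thesis
        using inner[OF a(1,2)] card_fan_cut_ge[OF assms(1) AB \<open>0 \<in> A\<close>] by linarith
    qed
    obtain A B H H' where C: "C = cut ?G A B" and AB: "A \<union> B = {0..m}" "A \<inter> B = {}"
      and H: "H \<in> ?S" "verts H \<subseteq> A" and H': "H' \<in> ?S" "verts H' \<subseteq> B"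
      using egg_cut unfolding egg_cuts_def verts_fan by blast
    have "0 \<in> A \<or> 0 \<in> B" using AB by auto
    then show ?thesis
    proof
      assume "0 \<in> A"
      then show ?thesis using side[OF AB H'] C by simp
    next
      assume "0 \<in> B"
      then have "N \<le> card (cut ?G B A)"
        using side[of B A H] AB H by (simp add: Un_commute Int_commute)
      then show ?thesis using C cut_commute by metis
    qed
  qed
  ultimately show ?thesis
    by (simp add: le_scramble_order_iff)
qed

section \<open>The scramble number of the fan\<close>

lemma nat_floor_sqrt_eq:
  assumes "c \<le> 2 * k"
  shows "nat \<lfloor>sqrt (real (k\<^sup>2 + c))\<rfloor> = k"
proof -
  have "k\<^sup>2 + c < (k + 1)\<^sup>2"
    using assms by (simp add: power2_eq_square)
  then have "real (k\<^sup>2 + c) < (real k + 1)\<^sup>2"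
    by (metis of_nat_1 of_nat_add of_nat_less_iff of_nat_power)
  then have "sqrt (real (k\<^sup>2 + c)) < real k + 1"
    by (intro real_less_lsqrt) auto
  moreover have "real k \<le> sqrt (real (k\<^sup>2 + c))"
    by (rule real_le_rsqrt) simp
  ultimately have "\<lfloor>sqrt (real (k\<^sup>2 + c))\<rfloor> = int k"
    by (simp add: floor_eq_iff)
  then show ?thesis by simp
qed

theorem lemma3p1:
  fixes m k c :: nat
  assumes "m \<ge> 2"
    and "k > 0"
    and "c \<le> 2 * k"
    and "m = k\<^sup>2 + c"
  shows "scramble_number (fan_graph m) =
    (if c \<le> k + 1 then enat (nat \<lfloor>sqrt (real m)\<rfloor> + 1)
     else enat (nat \<lfloor>sqrt (real m)\<rfloor> + 2))"
proof (cases "c \<le> k + 1")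
  case True
  have "scramble_number (fan_graph m) = enat (k + 1)"
  proof (rule scramble_number_eqI)
    show "scramble (fan_graph m) (segment_scramble 1 m k)"
      using assms by (intro scramble_segment_scramble) auto
    show "enat (k + 1) \<le> scramble_order (fan_graph m) (segment_scramble 1 m k)"
    proof (rule fan_scramble_order_lower[where n = k])
      fix a assume a: "1 \<le> a" "a + k \<le> Suc m"
      \<comment> \<open>A segment of length \<open>k < m\<close> cannot contain both ends of the path.\<close>
      have "k < m"
        using assms by (cases "k = 1") (auto simp: power2_eq_square intro: less_le_trans[of k "k * k"])
      then have "{a..<a + k} - {1, m} = {a..<a + k} - {1} \<or> {a..<a + k} - {1, m} = {a..<a + k} - {m}"
        using a by (cases "a = 1") auto
      moreover have "k - 1 \<le> card ({a..<a + k} - {x})" for x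
        by (simp add: card_Diff_singleton_if)
      ultimately have "k - 1 \<le> card ({a..<a + k} - {1, m})"
        by metis
      then show "k + 1 \<le> card ({a..<a + k} - {1, m}) + 2"
        by linarith
    qed (use assms in \<open>auto simp: power2_eq_square\<close>)
    fix S assume S: "scramble (fan_graph m) S"
    \<comment> \<open>Order \<open>k + 2\<close> would need \<open>k\<^sup>2 + k + 2\<close> path vertices.\<close>
    show "\<not> enat (Suc (k + 1)) \<le> scramble_order (fan_graph m) S"
      using fan_scramble_order_upper[OF assms(1) _ S, of k] assms True
      by (auto simp: power2_eq_square)
  qed simp
  then show ?thesis
    using True assms nat_floor_sqrt_eq by simp
next
  case False
  have "scramble_number (fan_graph m) = enat (k + 2)"
  proof (rule scramble_number_eqI)
    show "scramble (fan_graph m) (segment_scramble 2 (m - 1) k)"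
      using assms by (intro scramble_segment_scramble) auto
    show "enat (k + 2) \<le> scramble_order (fan_graph m) (segment_scramble 2 (m - 1) k)"
    proof (rule fan_scramble_order_lower[where n = "k + 1"])
      fix a assume "2 \<le> a" "a + k \<le> Suc (m - 1)"
      then have "{a..<a + k} - {1, m} = {a..<a + k}"
        using assms(1) by auto
      then show "k + 2 \<le> card ({a..<a + k} - {1, m}) + 2"
        by simp
    qed (use assms False in \<open>auto simp: power2_eq_square\<close>)
    fix S assume S: "scramble (fan_graph m) S"
    \<comment> \<open>Order \<open>k + 3\<close> would need \<open>(k + 1) * (k + 2) + 2\<close> path vertices, more than \<open>k\<^sup>2 + 2 * k\<close>.\<close>
    show "\<not> enat (Suc (k + 2)) \<le> scramble_order (fan_graph m) S"
      using fan_scramble_order_upper[OF assms(1) _ S, of "k + 1"] assms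
      by (auto simp: power2_eq_square)
  qed simp
  then show ?thesis
    using False assms nat_floor_sqrt_eq by simp
qed

end
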